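(* Let $n\ge 3$ and let $\gamma(t)=z(t)\big(0,1,r_3(t),\dots,r_n(t)\big)$, $t\in(-\varepsilon,\varepsilon)$, be a smooth curve in $\mathbb{M}(n)$, with smooth $z\colon(-\varepsilon,\varepsilon)\to\mathbb{C}\smallsetminus\{0\}$ and $r_j\colon(-\varepsilon,\varepsilon)\to\mathbb{R}$. Then $\gamma$ is a geodesic of $\mathbb{M}(n)$ if and only if there are real constants $k_0,k_1,k_3,\dots,k_n$ such that for all $t\in(-\varepsilon,\varepsilon)$: (I) $\Big(1+\sum_{j=3}^n r_j(t)^2\Big)\big[z'(t)\cdot iz(t)\big]=k_1$; (II) $z''(t)\cdot z(t)=0$; (III) $r_j'(t)\,\|z(t)\|^2=k_j$ for each $3\le j\le n$; (IV) $\displaystyle \sum_{j=3}^n r_j'(t)^2\|z(t)\|^2+\sum_{j=3}^n 2r_j'(t)r_j(t)\,\big(z(t)\cdot z'(t)\big)+\Big(1+\sum_{j=3}^n r_j(t)^2\Big)\|z'(t)\|^2=k_0$.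
   Context: Let $n\ge 3$ and $\mathcal{D}_n=\{(b,\dots,b)\in\mathbb{C}^n : b\in\mathbb{C}\}$. $\mathbb{L}(n)\subset\mathbb{C}^n$ is the set of $n$-segments: points $(z_1,\dots,z_n)\in\mathbb{C}^n\smallsetminus\mathcal{D}_n$ such that $z_1,\dots,z_n$ lie on a common real straight line in $\mathbb{C}$. Let $V_n=\{(0,z_2,\dots,z_n)\in\mathbb{C}^n\}$ and $\mathbb{M}(n)=\mathbb{L}(n)\cap V_n=\{aX : a\in\mathbb{C}\smallsetminus\{0\},\ X\in (V_n\cap\mathbb{R}^n)\smallsetminus\{\vec 0\}\}$, a smooth real $n$-dimensional submanifold of $\mathbb{C}^n$. For complex numbers, $z\cdot w=\mathrm{Re}(z\overline w)$ is the Euclidean inner product in the plane and $\|z\|=|z|$. $\mathbb{C}^n\cong\mathbb{R}^{2n}$ carries the Euclidean inner product $\langle\!\langle Z,W\rangle\!\rangle=\sum_j z_j\cdot w_j$, and $\mathbb{M}(n)$ the induced Riemannian metric. A curve $\gamma$ in $\mathbb{M}(n)$ is a geodesic if it has constant speed and $\gamma''(t)$ is orthogonal to the (linear) tangent space of $\mathbb{M}(n)$ at $\gamma(t)$ for every $t$. *)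

theory Defs
  imports "HOL-Analysis.Analysis"
begin

abbreviation ddt :: "(real \<Rightarrow> 'a::real_normed_vector) \<Rightarrow> real \<Rightarrow> 'a" where
  "ddt f \<equiv> (\<lambda>t. vector_derivative f (at t))"

text \<open>Infinite differentiability on \<open>I\<close>, with \<open>D k\<close> the \<open>k\<close>-th derivative. The derivatives are
  two-sided, so this is the usual notion for open \<open>I\<close> only.\<close>

definition smooth_on :: "real set \<Rightarrow> (real \<Rightarrow> 'a::real_normed_vector) \<Rightarrow> bool" where
  "smooth_on I f \<longleftrightarrow>
     (\<exists>D :: nat \<Rightarrow> real \<Rightarrow> 'a. D 0 = f \<and>
        (\<forall>k. \<forall>t\<in>I. (D k has_vector_derivative D (Suc k) t) (at t)))"

definition smooth_curve_in ::
  "'a::real_normed_vector set \<Rightarrow> real set \<Rightarrow> (real \<Rightarrow> 'a) \<Rightarrow> bool" where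
  "smooth_curve_in M I c \<longleftrightarrow> smooth_on I c \<and> c ` I \<subseteq> M"

text \<open>The linear tangent space of an embedded submanifold \<open>M\<close> at \<open>p\<close>, as the set of velocities
  at \<open>p\<close> of smooth curves lying in \<open>M\<close>.\<close>

definition tangent_space :: "'a::real_normed_vector set \<Rightarrow> 'a \<Rightarrow> 'a set" where
  "tangent_space M p =
     {v. \<exists>\<delta>>0. \<exists>c. smooth_curve_in M {-\<delta><..<\<delta>} c \<and> c 0 = p \<and> ddt c 0 = v}"

definition is_geodesic ::
  "'a::euclidean_space set \<Rightarrow> real set \<Rightarrow> (real \<Rightarrow> 'a) \<Rightarrow> bool" where
  "is_geodesic M I c \<longleftrightarrow>
     smooth_curve_in M I c \<and>
     (\<exists>s. \<forall>t\<in>I. norm (ddt c t) = s) \<and>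
     (\<forall>t\<in>I. \<forall>v\<in>tangent_space M (c t). orthogonal (ddt (ddt c) t) v)"

text \<open>The space of complex \<open>n\<close>-tuples is \<open>complex ^ 'n\<close> with \<open>n = CARD('n)\<close>. Its library inner
  product is the real one, the sum over \<open>j\<close> of \<open>Re (Z $ j * cnj (W $ j))\<close>, and \<open>range vec\<close> is
  the diagonal.\<close>

definition n_segments :: "(complex ^ 'n) set" where
  "n_segments = {Z. Z \<notin> range vec \<and> collinear (range (\<lambda>j. Z $ j))}"

text \<open>The argument \<open>i\<close> of the next two definitions is the index of the first coordinate.\<close>

definition V_space :: "'n \<Rightarrow> (complex ^ 'n) set" where
  "V_space i = {Z. Z $ i = 0}"

definition M_space :: "'n \<Rightarrow> (complex ^ 'n) set" where
  "M_space i = n_segments \<inter> V_space i"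

end

theory Submission imports Defs begin

text \<open>Writing \<open>\<gamma> = z X\<close> with \<open>X = (0, 1, r\<^sub>3, \<dots>, r\<^sub>n)\<close>, the tangent space at \<open>z X\<close> consists of the
  vectors \<open>w X + z \<rho>\<close> with \<open>w\<close> complex and \<open>\<rho>\<close> real, \<open>\<rho>\<^sub>1 = 0\<close>. Orthogonality of \<open>\<gamma>''\<close> to \<open>z \<rho>\<close> for
  the second unit vector \<open>\<rho>\<close> is (II); given (II), orthogonality for the \<open>j\<close>-th unit vector says that
  the derivative of \<open>r\<^sub>j' |z|\<^sup>2\<close> vanishes. Orthogonality to \<open>\<i> z X\<close> says that the derivative of
  \<open>|X|\<^sup>2 (z' \<bullet> \<i> z)\<close> vanishes, and orthogonality to \<open>z X\<close> is the case \<open>\<rho> = X\<close>. The left-hand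
  side of (IV) is the squared speed.\<close>

section \<open>Smooth curves and constancy on an interval\<close>

lemma smooth_on_ddt:
  assumes "open I" and "smooth_on I f"
  shows "smooth_on I (ddt f)"
proof -
  obtain D where D0: "D 0 = f"
    and D: "\<And>k t. t \<in> I \<Longrightarrow> (D k has_vector_derivative D (Suc k) t) (at t)"
    using assms(2) unfolding smooth_on_def by blast
  have eq: "D 1 t = ddt f t" if "t \<in> I" for t
    using D[OF that, of 0] D0 by (simp add: vector_derivative_at)
  \<comment> \<open>\<open>smooth_on\<close> demands that the zeroth derivative equal the function
    everywhere, whereas \<open>D 1\<close> agrees with \<open>ddt f\<close> only on
    \<open>I\<close>. So the shifted sequence starts with \<open>ddt f\<close> itself.\<close>
  define E where "E k = (if k = 0 then ddt f else D (Suc k))" for k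
  have "(E k has_vector_derivative E (Suc k) t) (at t)" if t: "t \<in> I" for k t
  proof (cases "k = 0")
    case True
    have "(D 1 has_vector_derivative D 2 t) (at t)"
      using D[OF t, of 1] by (simp add: numeral_2_eq_2)
    then have "(ddt f has_vector_derivative D 2 t) (at t)"
      by (rule has_vector_derivative_transform_within_open[OF _ assms(1) t]) (rule eq)
    then show ?thesis using True by (simp add: E_def numeral_2_eq_2)
  next
    case False
    then show ?thesis using D[OF t, of "Suc k"] by (simp add: E_def)
  qed
  moreover have "E 0 = ddt f" by (simp add: E_def)
  ultimately show ?thesis unfolding smooth_on_def by (intro exI[of _ E] conjI ballI allI)
qed

lemma smooth_on_has_ddt:
  assumes "smooth_on I f" and "t \<in> I"
  shows "(f has_vector_derivative ddt f t) (at t)"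
proof -
  obtain D where "D 0 = f" "(D 0 has_vector_derivative D (Suc 0) t) (at t)"
    using assms unfolding smooth_on_def by blast
  then show ?thesis
    by (simp add: vector_derivative_at)
qed

text \<open>The curves that realise tangent vectors below have this form; constant functions are the
  case \<open>v = u = 0\<close>.\<close>

lemma smooth_on_quadratic: "smooth_on I (\<lambda>s. p + s *\<^sub>R v + s\<^sup>2 *\<^sub>R u)"
proof -
  define D where "D k = (\<lambda>s::real. if k = 0 then p + s *\<^sub>R v + s\<^sup>2 *\<^sub>R u
      else if k = 1 then v + (2 * s) *\<^sub>R u else if k = 2 then 2 *\<^sub>R u else 0)" for k :: nat
  have "(D k has_vector_derivative D (Suc k) t) (at t)" for k t
  proof -
    consider "k = 0" | "k = 1" | "k = 2" | "k > 2" by linarith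
    then show ?thesis
      by cases (auto simp: D_def intro!: derivative_eq_intros)
  qed
  moreover have "D 0 = (\<lambda>s. p + s *\<^sub>R v + s\<^sup>2 *\<^sub>R u)" by (simp add: D_def)
  ultimately show ?thesis unfolding smooth_on_def by (intro exI[of _ D] conjI ballI allI)
qed

text \<open>Turns the conserved quantities of (I) and (III) into pointwise equations, the form in
  which orthogonality of the acceleration delivers them.\<close>

lemma constant_iff_derivative_zero:
  fixes f :: "real \<Rightarrow> 'a::real_normed_vector"
  assumes "open I" "convex I" and f: "\<And>t. t \<in> I \<Longrightarrow> (f has_vector_derivative f' t) (at t)"
  shows "(\<exists>k. \<forall>t\<in>I. f t = k) \<longleftrightarrow> (\<forall>t\<in>I. f' t = 0)"
proof
  assume "\<exists>k. \<forall>t\<in>I. f t = k"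
  then obtain k where k: "\<And>t. t \<in> I \<Longrightarrow> f t = k" by blast
  show "\<forall>t\<in>I. f' t = 0"
  proof
    fix t assume t: "t \<in> I"
    have "(f has_vector_derivative 0) (at t)"
      by (rule has_vector_derivative_transform_within_open[OF _ assms(1) t, of "\<lambda>_. k"])
        (auto simp: k)
    then show "f' t = 0" using f[OF t] by (simp add: vector_derivative_unique_at)
  qed
next
  assume 0: "\<forall>t\<in>I. f' t = 0"
  have "(f has_derivative (\<lambda>h. 0)) (at t within I)" if "t \<in> I" for t
    using f[OF that] 0 that unfolding has_vector_derivative_def
    by (auto intro: has_derivative_at_withinI)
  then show "\<exists>k. \<forall>t\<in>I. f t = k"
    using has_derivative_zero_constant[OF assms(2)] by metis
qed

section \<open>Equations for the submanifold and its tangent spaces\<close>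

text \<open>A line through all coordinates contains \<open>Z $ i = 0\<close>, so collinearity means
  that all coordinates are real multiples of one vector, and the diagonal shrinks to 0. The
  resulting equations are bilinear over the reals and can be differentiated along a curve.\<close>

lemma M_space_iff:
  "Z \<in> M_space i \<longleftrightarrow> Z $ i = 0 \<and> Z \<noteq> 0 \<and> (\<forall>j k. Im (Z $ j * cnj (Z $ k)) = 0)"
proof (cases "Z $ i = 0")
  case True
  have vec: "Z \<in> range vec \<longleftrightarrow> Z = 0"
    using True by (auto simp: vec_eq_iff)
  have "collinear (range (\<lambda>j. Z $ j)) \<longleftrightarrow> (\<forall>j k. Im (Z $ j * cnj (Z $ k)) = 0)"
  proof
    assume "collinear (range (\<lambda>j. Z $ j))"
    then obtain u where u: "\<And>x y. x \<in> range (\<lambda>j. Z $ j) \<Longrightarrow> y \<in> range (\<lambda>j. Z $ j) \<Longrightarrow>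
        \<exists>c. x - y = c *\<^sub>R u"
      unfolding collinear_def by blast
    have *: "\<exists>c. Z $ j = c *\<^sub>R u" for j
      using u[of "Z $ j" "Z $ i"] True by auto
    show "\<forall>j k. Im (Z $ j * cnj (Z $ k)) = 0"
    proof (intro allI)
      fix j k
      obtain c d where "Z $ j = c *\<^sub>R u" "Z $ k = d *\<^sub>R u" using * by blast
      then show "Im (Z $ j * cnj (Z $ k)) = 0" by (simp add: algebra_simps)
    qed
  next
    assume im: "\<forall>j k. Im (Z $ j * cnj (Z $ k)) = 0"
    show "collinear (range (\<lambda>j. Z $ j))"
    proof (cases "Z = 0")
      case True
      then have "range (\<lambda>j. Z $ j) = {0}" by auto
      then show ?thesis by simp
    next
      case False
      then obtain k where k: "Z $ k \<noteq> 0" by (auto simp: vec_eq_iff)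
      have *: "\<exists>c. Z $ j = c *\<^sub>R Z $ k" for j
      proof
        have "Z $ j * cnj (Z $ k) = of_real (Re (Z $ j * cnj (Z $ k)))"
          using im by (simp add: complex_eq_iff)
        then have "Z $ j * (Z $ k * cnj (Z $ k)) = of_real (Re (Z $ j * cnj (Z $ k))) * Z $ k"
          by (metis mult.assoc mult.commute)
        \<comment> \<open>Dividing the real number \<open>Z $ j * cnj (Z $ k)\<close> by the squared
          modulus of \<open>Z $ k\<close> gives the quotient \<open>Z $ j / Z $ k\<close>, which is
          therefore real.\<close>
        then show "Z $ j = (Re (Z $ j * cnj (Z $ k)) / (cmod (Z $ k))\<^sup>2) *\<^sub>R Z $ k"
          using k by (simp add: complex_norm_square[symmetric] scaleR_conv_of_real field_simps)
      qed
      have "\<exists>c. Z $ j - Z $ m = c *\<^sub>R Z $ k" for j m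
        using *[of j] *[of m] by (metis scaleR_left_diff_distrib)
      then show ?thesis unfolding collinear_def by blast
    qed
  qed
  then show ?thesis using True vec by (simp add: M_space_def V_space_def n_segments_def)
qed (simp add: M_space_def V_space_def)

lemma real_multiple_in_M_space:
  assumes "\<And>j. Z $ j = a * of_real (X j)" and "X i = 0" and "Z \<noteq> 0"
  shows "Z \<in> M_space i"
  unfolding M_space_iff using assms by (auto simp: algebra_simps)

text \<open>Velocities satisfy the derivatives of the equations in \<open>M_space_iff\<close>, which
  forces the stated form. Conversely, the product rule shows that moving \<open>a\<close> with
  velocity \<open>w\<close> and \<open>X\<close> with velocity \<rho> realises every such
  vector.\<close>

lemma tangent_space_M_space:
  assumes p: "\<And>j. p $ j = a * of_real (X j)" and "a \<noteq> 0" and Xi: "X i = 0" and "X k = 1"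
  shows "tangent_space (M_space i) p =
    {v. \<exists>w \<rho>. \<rho> i = 0 \<and> (\<forall>j. v $ j = w * of_real (X j) + a * of_real (\<rho> j))}"
proof (intro equalityI subsetI; clarsimp)
  fix v assume "v \<in> tangent_space (M_space i) p"
  then obtain \<delta> c where "\<delta> > 0" and sm: "smooth_on {-\<delta><..<\<delta>} c"
    and im: "c ` {-\<delta><..<\<delta>} \<subseteq> M_space i" and c0: "c 0 = p" and v: "ddt c 0 = v"
    unfolding tangent_space_def smooth_curve_in_def by blast
  let ?J = "{-\<delta><..<\<delta>}"
  have J: "open ?J" "0 \<in> ?J" using \<open>\<delta> > 0\<close> by auto
  have dc: "((\<lambda>s. c s $ j) has_vector_derivative v $ j) (at 0)" for j
    using bounded_linear.has_vector_derivative[OF bounded_linear_vec_nth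
        smooth_on_has_ddt[OF sm J(2)]] v by simp
  have zero: "D = 0" if "(f has_vector_derivative D) (at 0)" "\<And>s. s \<in> ?J \<Longrightarrow> f s = 0"
    for f and D :: "'b::real_normed_vector"
    using has_vector_derivative_transform_within_open[OF that(1) J(1,2), of "\<lambda>_. 0"] that(2)
    by (metis has_vector_derivative_const vector_derivative_unique_at)
  have inM: "c s $ i = 0" "Im (c s $ j * cnj (c s $ m)) = 0" if "s \<in> ?J" for s j m
    using im that by (auto simp: M_space_iff image_subset_iff)
  have vi: "v $ i = 0"
    using inM(1) by (rule zero[OF dc])
  \<comment> \<open>The derivative at 0 of the equation for the pair \<open>j\<close>,
    \<open>k\<close>, where \<open>p $ k = a\<close> because \<open>X k = 1\<close>.\<close>
  have Im0: "Im (a * cnj (v $ k) * of_real (X j) + v $ j * cnj a) = 0" for j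
  proof -
    have "((\<lambda>s. c s $ j * cnj (c s $ k)) has_vector_derivative
        c 0 $ j * cnj (v $ k) + v $ j * cnj (c 0 $ k)) (at 0)"
      by (intro has_vector_derivative_mult dc
          bounded_linear.has_vector_derivative[OF bounded_linear_cnj])
    from bounded_linear.has_vector_derivative[OF bounded_linear_Im this]
    have "Im (c 0 $ j * cnj (v $ k) + v $ j * cnj (c 0 $ k)) = 0"
      using inM(2) by (rule zero)
    then show ?thesis by (simp add: c0 p \<open>X k = 1\<close> mult_ac)
  qed
  \<comment> \<open>At index \<open>k\<close> the choice \<open>w = v $ k\<close> leaves \<rho>
    equal to 0; elsewhere \<rho> is the remainder divided by \<open>a\<close>. \<open>Im0\<close>
    makes that quotient real, so taking \<open>Re\<close> loses nothing.\<close>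
  define \<rho> where "\<rho> j = Re ((v $ j - v $ k * of_real (X j)) / a)" for j
  have "v $ j = v $ k * of_real (X j) + a * of_real (\<rho> j)" for j
  proof -
    have "Im ((v $ j - v $ k * of_real (X j)) * cnj a) = 0"
      using Im0[of j] by (simp add: algebra_simps)
    then have "Im ((v $ j - v $ k * of_real (X j)) / a) = 0"
      by (simp add: Im_complex_div_eq_0)
    then have "of_real (\<rho> j) = (v $ j - v $ k * of_real (X j)) / a"
      by (simp add: \<rho>_def complex_eq_iff)
    then show ?thesis using \<open>a \<noteq> 0\<close> by simp
  qed
  moreover have "\<rho> i = 0" by (simp add: \<rho>_def vi Xi)
  ultimately show "\<exists>w \<rho>. \<rho> i = 0 \<and> (\<forall>j. v $ j = w * of_real (X j) + a * of_real (\<rho> j))"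
    by blast
next
  fix v w and \<rho> :: "'a \<Rightarrow> real"
  assume \<rho>: "\<rho> i = 0" and v: "\<forall>j. v $ j = w * of_real (X j) + a * of_real (\<rho> j)"
  \<comment> \<open>The expansion of \<open>(a + s w) (X + s \<rho>)\<close> in powers of
    \<open>s\<close>: the linear coefficient is \<open>v\<close>, the quadratic one
    \<open>w \<rho>\<close>.\<close>
  define c where "c s = p + s *\<^sub>R v + s\<^sup>2 *\<^sub>R (\<chi> j. w * of_real (\<rho> j))" for s :: real
  have c: "c s $ j = (a + of_real s * w) * of_real (X j + s * \<rho> j)" for s j
    by (simp add: c_def p v) (simp add: scaleR_conv_of_real algebra_simps power2_eq_square)
  have sm: "smooth_on J c" for J
    unfolding c_def by (rule smooth_on_quadratic)
  have "p \<noteq> 0" using p[of k] \<open>a \<noteq> 0\<close> \<open>X k = 1\<close> by auto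
  have "isCont c 0"
    unfolding c_def by (intro continuous_intros)
  moreover have "c 0 = p" by (simp add: c_def)
  \<comment> \<open>Points of \<open>M_space i\<close> must be nonzero, which continuity guarantees
    only for small \<open>s\<close>.\<close>
  ultimately obtain \<delta> where "\<delta> > 0" and \<delta>: "\<And>s. dist s 0 < \<delta> \<Longrightarrow> c s \<noteq> 0"
    using continuous_at_avoid[of 0 c 0] \<open>p \<noteq> 0\<close> by (metis dist_commute)
  have "c s \<in> M_space i" if "s \<in> {-\<delta><..<\<delta>}" for s
    by (rule real_multiple_in_M_space[OF c]) (use that \<rho> Xi \<delta> in auto)
  then have "smooth_curve_in (M_space i) {-\<delta><..<\<delta>} c"
    using sm by (auto simp: smooth_curve_in_def)
  moreover have "ddt c 0 = v"
    unfolding c_def by (rule vector_derivative_at) (auto intro!: derivative_eq_intros)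
  ultimately show "v \<in> tangent_space (M_space i) p"
    using \<open>\<delta> > 0\<close> \<open>c 0 = p\<close> unfolding tangent_space_def by blast
qed

text \<open>Over the reals the tangent space is spanned by \<open>\<i> a X\<close> and by the
  vectors with a single nonzero coordinate \<open>a\<close>, at an index other than
  \<open>i\<close>. Testing against these suffices, and at \<open>i\<close> itself the condition is
  trivial by \<open>Ai\<close>.\<close>

lemma orthogonal_tangent_space_M_space_iff:
  fixes A p :: "complex ^ 'n"
  assumes p: "\<And>j. p $ j = a * of_real (X j)" and "a \<noteq> 0" and "X i = 0" and "X k = 1"
    and Ai: "A $ i = 0"
  shows "(\<forall>v\<in>tangent_space (M_space i) p. orthogonal A v) \<longleftrightarrow>
    (\<forall>j. A $ j \<bullet> a = 0) \<and> (\<Sum>j\<in>UNIV. X j * (A $ j \<bullet> (\<i> * a))) = 0"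
    (is "?L \<longleftrightarrow> ?R")
proof
  note T = tangent_space_M_space[OF assms(1-4)]
  assume L: ?L
  have "A $ j \<bullet> a = 0" for j
  proof (cases "j = i")
    case False
    let ?v = "\<chi> m. a * of_real (if m = j then 1 else 0)"
    have "?v \<in> tangent_space (M_space i) p"
      unfolding T using False
      by (auto intro!: exI[of _ 0] exI[of _ "\<lambda>m. if m = j then 1 else 0"])
    then have "A \<bullet> ?v = 0" using L by (auto simp: orthogonal_def)
    moreover have "A \<bullet> ?v = (\<Sum>m\<in>UNIV. if m = j then A $ j \<bullet> a else 0)"
      unfolding inner_vec_def by (rule sum.cong) auto
    ultimately show ?thesis by simp
  qed (simp add: Ai)
  moreover have "(\<chi> m. \<i> * a * of_real (X m)) \<in> tangent_space (M_space i) p"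
    unfolding T by (auto intro!: exI[of _ "\<i> * a"] exI[of _ "\<lambda>m. 0"])
  then have "A \<bullet> (\<chi> m. \<i> * a * of_real (X m)) = 0" using L by (auto simp: orthogonal_def)
  then have "(\<Sum>j\<in>UNIV. X j * (A $ j \<bullet> (\<i> * a))) = 0"
    by (simp add: inner_vec_def inner_complex_def algebra_simps)
  ultimately show ?R by blast
next
  assume R: ?R
  show ?L
  proof
    fix v assume "v \<in> tangent_space (M_space i) p"
    then obtain w \<rho> where v: "\<And>j. v $ j = w * of_real (X j) + a * of_real (\<rho> j)"
      unfolding tangent_space_M_space[OF assms(1-4)] by blast
    \<comment> \<open>Splits \<open>w\<close> along \<open>a\<close> and \<open>\<i> a\<close>. The
      part along \<open>a\<close> has the same direction as the \<rho> term and merges with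
      it.\<close>
    define \<alpha> \<beta> where "\<alpha> = Re (w / a)" and "\<beta> = Im (w / a)"
    have "w = (of_real \<alpha> + \<i> * of_real \<beta>) * a"
      unfolding \<alpha>_def \<beta>_def complex_eq[symmetric] using \<open>a \<noteq> 0\<close> by simp
    then have "v $ j = (\<alpha> * X j + \<rho> j) *\<^sub>R a + (\<beta> * X j) *\<^sub>R (\<i> * a)" for j
      unfolding v by (simp add: scaleR_conv_of_real algebra_simps)
    then have "A \<bullet> v = (\<Sum>j\<in>UNIV. \<beta> * (X j * (A $ j \<bullet> (\<i> * a))))"
      using R by (simp add: inner_vec_def inner_add_right mult_ac)
    also have "\<dots> = 0" using R by (simp add: sum_distrib_left[symmetric])
    finally show "orthogonal A v" by (simp add: orthogonal_def)
  qed
qed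

section \<open>The geodesic equations\<close>

text \<open>Treating the coordinates 0 and 1 as constant functions \<open>X i\<close> and
  \<open>X k\<close> lets all sums run over the whole index type, so that no index needs separate
  treatment in the differentiations.\<close>

lemma geodesic_M_space_iff:
  fixes \<gamma> :: "real \<Rightarrow> complex ^ 'n" and X :: "'n \<Rightarrow> real \<Rightarrow> real"
  assumes I: "open I" "convex I"
    and z: "smooth_on I z" "\<And>t. t \<in> I \<Longrightarrow> z t \<noteq> 0"
    and X: "\<And>m. smooth_on I (X m)" "X i = (\<lambda>_. 0)" "X k = (\<lambda>_. 1)"
    and \<gamma>: "smooth_curve_in (M_space i) I \<gamma>"
    and coords: "\<And>t m. t \<in> I \<Longrightarrow> \<gamma> t $ m = z t * of_real (X m t)"
  shows "is_geodesic (M_space i) I \<gamma> \<longleftrightarrow>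
    (\<exists>k1. \<forall>t\<in>I. (\<Sum>m\<in>UNIV. (X m t)\<^sup>2) * (ddt z t \<bullet> (\<i> * z t)) = k1) \<and>
    (\<forall>t\<in>I. ddt (ddt z) t \<bullet> z t = 0) \<and>
    (\<forall>m. \<exists>c. \<forall>t\<in>I. ddt (X m) t * (norm (z t))\<^sup>2 = c) \<and>
    (\<exists>k0. \<forall>t\<in>I. (\<Sum>m\<in>UNIV. (ddt (X m) t)\<^sup>2 * (norm (z t))\<^sup>2)
         + (\<Sum>m\<in>UNIV. 2 * ddt (X m) t * X m t * (z t \<bullet> ddt z t))
         + (\<Sum>m\<in>UNIV. (X m t)\<^sup>2) * (norm (ddt z t))\<^sup>2 = k0)"
    (is "_ \<longleftrightarrow> ?I \<and> ?II \<and> ?III \<and> (\<exists>k0. \<forall>t\<in>I. ?sp t = k0)")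
proof -
  define z1 z2 where "z1 = ddt z" and "z2 = ddt (ddt z)"
  define X1 X2 where "X1 m = ddt (X m)" and "X2 m = ddt (ddt (X m))" for m
  have dz: "(z has_vector_derivative z1 t) (at t)" "(z1 has_vector_derivative z2 t) (at t)"
    and dX: "(X m has_vector_derivative X1 m t) (at t)"
      "(X1 m has_vector_derivative X2 m t) (at t)" if "t \<in> I" for t m
    unfolding z1_def z2_def X1_def X2_def
    using that z(1) X(1) smooth_on_ddt[OF I(1)] by (blast intro: smooth_on_has_ddt)+
  have sm: "smooth_on I \<gamma>" using \<gamma> by (simp add: smooth_curve_in_def)
  have dg: "((\<lambda>t. \<gamma> t $ m) has_vector_derivative ddt \<gamma> t $ m) (at t)"
    "((\<lambda>t. ddt \<gamma> t $ m) has_vector_derivative ddt (ddt \<gamma>) t $ m) (at t)" if t: "t \<in> I" for t m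
    by (rule bounded_linear.has_vector_derivative[OF bounded_linear_vec_nth];
        use t sm smooth_on_ddt[OF I(1)] in \<open>blast intro: smooth_on_has_ddt\<close>)+
  have ofr: "((\<lambda>t. complex_of_real (f t)) has_vector_derivative of_real f') (at t)"
    if "(f has_vector_derivative f') (at t)" for f f' t
    using bounded_linear.has_vector_derivative[OF bounded_linear_of_real that] .
  have g1: "ddt \<gamma> t $ m = z1 t * of_real (X m t) + z t * of_real (X1 m t)" if t: "t \<in> I" for t m
  proof -
    have "((\<lambda>t. z t * of_real (X m t)) has_vector_derivative
        z t * of_real (X1 m t) + z1 t * of_real (X m t)) (at t)"
      using t by (intro has_vector_derivative_mult ofr dz dX)
    then have "((\<lambda>t. \<gamma> t $ m) has_vector_derivative
        z t * of_real (X1 m t) + z1 t * of_real (X m t)) (at t)"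
      by (rule has_vector_derivative_transform_within_open[OF _ I(1) t]) (simp add: coords)
    from vector_derivative_unique_at[OF dg(1)[OF t] this]
    show ?thesis by (simp add: add.commute)
  qed
  have g2: "ddt (ddt \<gamma>) t $ m =
      z2 t * of_real (X m t) + 2 * z1 t * of_real (X1 m t) + z t * of_real (X2 m t)"
    if t: "t \<in> I" for t m
  proof -
    have "((\<lambda>t. z1 t * of_real (X m t) + z t * of_real (X1 m t)) has_vector_derivative
        (z1 t * of_real (X1 m t) + z2 t * of_real (X m t)) +
        (z t * of_real (X2 m t) + z1 t * of_real (X1 m t))) (at t)"
      using t by (intro has_vector_derivative_add has_vector_derivative_mult ofr dz dX)
    then have "((\<lambda>t. ddt \<gamma> t $ m) has_vector_derivative
        (z1 t * of_real (X1 m t) + z2 t * of_real (X m t)) +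
        (z t * of_real (X2 m t) + z1 t * of_real (X1 m t))) (at t)"
      by (rule has_vector_derivative_transform_within_open[OF _ I(1) t]) (simp add: g1)
    from vector_derivative_unique_at[OF dg(2)[OF t] this]
    show ?thesis by (simp add: algebra_simps)
  qed
  have X12: "X1 i t = 0" "X2 i t = 0" "X1 k t = 0" "X2 k t = 0" for t
    by (simp_all add: X1_def X2_def X)

  have speed: "(norm (ddt \<gamma> t))\<^sup>2 = ?sp t" if t: "t \<in> I" for t
  proof -
    have "(norm (ddt \<gamma> t))\<^sup>2 = (\<Sum>m\<in>UNIV. (X1 m t)\<^sup>2 * (norm (z t))\<^sup>2 +
        2 * X1 m t * X m t * (z t \<bullet> z1 t) + (X m t)\<^sup>2 * (norm (z1 t))\<^sup>2)"
      unfolding power2_norm_eq_inner inner_vec_def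
      by (rule sum.cong) (simp_all add: g1[OF t] inner_complex_def power2_eq_square algebra_simps)
    then show ?thesis
      by (simp add: sum.distrib sum_distrib_right X1_def z1_def)
  qed
  have "(\<exists>s. \<forall>t\<in>I. norm (ddt \<gamma> t) = s) \<longleftrightarrow> (\<exists>s. \<forall>t\<in>I. (norm (ddt \<gamma> t))\<^sup>2 = s)"
    by (metis norm_ge_zero real_sqrt_unique)
  also have "\<dots> \<longleftrightarrow> (\<exists>k0. \<forall>t\<in>I. ?sp t = k0)" using speed by simp
  finally have IV: "(\<exists>s. \<forall>t\<in>I. norm (ddt \<gamma> t) = s) \<longleftrightarrow> (\<exists>k0. \<forall>t\<in>I. ?sp t = k0)" .

  have orth: "(\<forall>v\<in>tangent_space (M_space i) (\<gamma> t). orthogonal (ddt (ddt \<gamma>) t) v) \<longleftrightarrow>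
      (\<forall>m. ddt (ddt \<gamma>) t $ m \<bullet> z t = 0) \<and>
      (\<Sum>m\<in>UNIV. X m t * (ddt (ddt \<gamma>) t $ m \<bullet> (\<i> * z t))) = 0" if t: "t \<in> I" for t
    using t by (intro orthogonal_tangent_space_M_space_iff[where k = k])
      (simp_all add: coords z X X12 g2)
  \<comment> \<open>The bracket is the derivative of \<open>X1 m t * (norm (z t))\<^sup>2\<close>,
    the quantity in (III).\<close>
  have tangential: "ddt (ddt \<gamma>) t $ m \<bullet> z t =
      X m t * (z2 t \<bullet> z t) + (2 * X1 m t * (z1 t \<bullet> z t) + X2 m t * (norm (z t))\<^sup>2)"
    if "t \<in> I" for t m
    unfolding power2_norm_eq_inner using that
    by (simp add: g2 inner_complex_def algebra_simps)
  \<comment> \<open>The terms with \<open>X2\<close> drop out because \<open>z t\<close> is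
    orthogonal to \<open>\<i> * z t\<close>. What remains is the derivative of the quantity in
    (I).\<close>
  have normal: "(\<Sum>m\<in>UNIV. X m t * (ddt (ddt \<gamma>) t $ m \<bullet> (\<i> * z t))) =
      (\<Sum>m\<in>UNIV. (X m t)\<^sup>2) * (z2 t \<bullet> (\<i> * z t)) +
      (\<Sum>m\<in>UNIV. 2 * X m t * X1 m t) * (z1 t \<bullet> (\<i> * z t))" if t: "t \<in> I" for t
    unfolding sum_distrib_right sum.distrib[symmetric]
    by (rule sum.cong) (simp_all add: g2[OF t] inner_complex_def power2_eq_square algebra_simps)

  have "((\<lambda>t. X1 m t * (norm (z t))\<^sup>2) has_vector_derivative
      2 * X1 m t * (z1 t \<bullet> z t) + X2 m t * (norm (z t))\<^sup>2) (at t)" if t: "t \<in> I" for t m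
  proof -
    have "((\<lambda>t. z t \<bullet> z t) has_vector_derivative z t \<bullet> z1 t + z1 t \<bullet> z t) (at t)"
      using bounded_bilinear.has_vector_derivative[OF bounded_bilinear_inner dz(1) dz(1)] t by blast
    from has_vector_derivative_mult[OF dX(2)[OF t] this, of m]
    show ?thesis
      unfolding power2_norm_eq_inner by (simp add: inner_commute algebra_simps)
  qed
  from constant_iff_derivative_zero[OF I this]
  have III: "?III \<longleftrightarrow>
      (\<forall>m. \<forall>t\<in>I. 2 * X1 m t * (z1 t \<bullet> z t) + X2 m t * (norm (z t))\<^sup>2 = 0)"
    by (simp add: X1_def)
  have "((\<lambda>t. (\<Sum>m\<in>UNIV. (X m t)\<^sup>2) * (z1 t \<bullet> (\<i> * z t))) has_vector_derivative
      (\<Sum>m\<in>UNIV. (X m t)\<^sup>2) * (z2 t \<bullet> (\<i> * z t)) +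
      (\<Sum>m\<in>UNIV. 2 * X m t * X1 m t) * (z1 t \<bullet> (\<i> * z t))) (at t)" if t: "t \<in> I" for t
  proof -
    have "((\<lambda>t. (X m t)\<^sup>2) has_vector_derivative 2 * X m t * X1 m t) (at t)" for m
      using has_vector_derivative_mult[OF dX(1)[OF t] dX(1)[OF t], of m m]
      by (simp add: power2_eq_square algebra_simps)
    then have S: "((\<lambda>t. \<Sum>m\<in>UNIV. (X m t)\<^sup>2) has_vector_derivative
        (\<Sum>m\<in>UNIV. 2 * X m t * X1 m t)) (at t)"
      by (intro has_vector_derivative_sum)
    have "((\<lambda>t. \<i> * z t) has_vector_derivative \<i> * z1 t) (at t)"
      using dz(1)[OF t] by (rule has_vector_derivative_mult_right)
    from bounded_bilinear.has_vector_derivative[OF bounded_bilinear_inner dz(2)[OF t] this]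
    \<comment> \<open>The other product-rule term \<open>z1 t \<bullet> (\<i> * z1 t)\<close>
      vanishes.\<close>
    have "((\<lambda>t. z1 t \<bullet> (\<i> * z t)) has_vector_derivative z2 t \<bullet> (\<i> * z t)) (at t)"
      by (simp add: inner_complex_def)
    from has_vector_derivative_mult[OF S this] show ?thesis by (simp add: algebra_simps)
  qed
  from constant_iff_derivative_zero[OF I this]
  have I1: "?I \<longleftrightarrow> (\<forall>t\<in>I. (\<Sum>m\<in>UNIV. X m t * (ddt (ddt \<gamma>) t $ m \<bullet> (\<i> * z t))) = 0)"
    by (simp add: normal z1_def)

  have "(\<forall>m. ddt (ddt \<gamma>) t $ m \<bullet> z t = 0) \<longleftrightarrow> z2 t \<bullet> z t = 0 \<and>
      (\<forall>m. 2 * X1 m t * (z1 t \<bullet> z t) + X2 m t * (norm (z t))\<^sup>2 = 0)" if t: "t \<in> I" for t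
  proof -
    \<comment> \<open>Since \<open>X k\<close> is constantly 1, the index \<open>k\<close> isolates
      (II). Once (II) holds, the first summand in \<open>tangential\<close> vanishes for every
      \<open>m\<close>, which leaves the derivative of (III).\<close>
    have "ddt (ddt \<gamma>) t $ k \<bullet> z t = z2 t \<bullet> z t"
      using tangential[OF t, of k] by (simp add: X X12)
    then show ?thesis using tangential[OF t] by (metis add_0 mult_zero_right)
  qed
  then have "(\<forall>t\<in>I. \<forall>v\<in>tangent_space (M_space i) (\<gamma> t). orthogonal (ddt (ddt \<gamma>) t) v) \<longleftrightarrow>
      ?I \<and> ?II \<and> ?III"
    unfolding I1 III using orth by (auto simp: z2_def)
  then show ?thesis
    unfolding is_geodesic_def IV using \<gamma> by blast
qed

section \<open>Constants and numbered coordinates\<close>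

text \<open>Each condition has its own constant, so the quantifiers separate; the constants indexed
  by \<open>J\<close> are gathered into one function by choice.\<close>

lemma collect_constants:
  "(\<exists>k1. \<forall>t\<in>I. A t = k1) \<and> (\<forall>t\<in>I. B t) \<and>
    (\<forall>j\<in>J. \<exists>c. \<forall>t\<in>I. C j t = c) \<and> (\<exists>k0. \<forall>t\<in>I. D t = k0) \<longleftrightarrow>
    (\<exists>k0 k1 k. \<forall>t\<in>I. A t = k1 \<and> B t \<and> (\<forall>j\<in>J. C j t = k j) \<and> D t = k0)"
  (is "?L \<longleftrightarrow> ?R")
proof
  assume ?L
  then have 1: "\<exists>k1. \<forall>t\<in>I. A t = k1" and 2: "\<forall>t\<in>I. B t"
    and 3: "\<forall>j\<in>J. \<exists>c. \<forall>t\<in>I. C j t = c" and 4: "\<exists>k0. \<forall>t\<in>I. D t = k0"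
    by simp_all
  from 1 obtain k1 where A: "\<forall>t\<in>I. A t = k1" ..
  from 4 obtain k0 where D: "\<forall>t\<in>I. D t = k0" ..
  from bchoice[OF 3] obtain k where C: "\<forall>j\<in>J. \<forall>t\<in>I. C j t = k j" ..
  have "\<forall>t\<in>I. A t = k1 \<and> B t \<and> (\<forall>j\<in>J. C j t = k j) \<and> D t = k0"
    using A 2 C D by simp
  then show ?R
    by (rule exI[of _ k0, OF exI[of _ k1, OF exI[of _ k]]])
next
  assume ?R
  then obtain k0 k1 k where
    *: "\<forall>t\<in>I. A t = k1 \<and> B t \<and> (\<forall>j\<in>J. C j t = k j) \<and> D t = k0" by (elim exE)
  show ?L
  proof (intro conjI ballI)
    show "\<exists>k1. \<forall>t\<in>I. A t = k1" using * by (intro exI[of _ k1]) simp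
    show "\<exists>k0. \<forall>t\<in>I. D t = k0" using * by (intro exI[of _ k0]) simp
    show "B t" if "t \<in> I" for t using * that by simp
    show "\<exists>c. \<forall>t\<in>I. C j t = c" if "j \<in> J" for j
      using * that by (intro exI[of _ "k j"]) simp
  qed
qed

theorem mainTheorem5:
  fixes \<epsilon> :: real
    and e :: "nat \<Rightarrow> 'n::finite"
    and \<gamma> :: "real \<Rightarrow> complex ^ 'n"
    and z :: "real \<Rightarrow> complex"
    and r :: "nat \<Rightarrow> real \<Rightarrow> real"
  defines "n \<equiv> CARD('n)"
    and "I \<equiv> {-\<epsilon><..<\<epsilon>}"
  assumes n_ge_3: "n \<ge> 3"
    and enum: "bij_betw e {1..n} UNIV"
    and eps: "\<epsilon> > 0"
    and z_smooth: "smooth_on I z"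
    and z_nz: "\<forall>t\<in>I. z t \<noteq> 0"
    and r_smooth: "\<forall>j\<in>{3..n}. smooth_on I (r j)"
    and curve: "smooth_curve_in (M_space (e 1)) I \<gamma>"
    and coords: "\<forall>t\<in>I. \<gamma> t $ e 1 = 0 \<and> \<gamma> t $ e 2 = z t \<and>
                   (\<forall>j\<in>{3..n}. \<gamma> t $ e j = z t * complex_of_real (r j t))"
  shows "is_geodesic (M_space (e 1)) I \<gamma> \<longleftrightarrow>
    (\<exists>(k0::real) (k1::real) (k::nat \<Rightarrow> real). \<forall>t\<in>I.
       (1 + (\<Sum>j=3..n. (r j t)\<^sup>2)) * (ddt z t \<bullet> (\<i> * z t)) = k1 \<and>
       ddt (ddt z) t \<bullet> z t = 0 \<and>
       (\<forall>j\<in>{3..n}. ddt (r j) t * (norm (z t))\<^sup>2 = k j) \<and>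
       (\<Sum>j=3..n. (ddt (r j) t)\<^sup>2 * (norm (z t))\<^sup>2)
         + (\<Sum>j=3..n. 2 * ddt (r j) t * r j t * (z t \<bullet> ddt z t))
         + (1 + (\<Sum>j=3..n. (r j t)\<^sup>2)) * (norm (ddt z t))\<^sup>2 = k0)"
proof -
  \<comment> \<open>Carries the numbered functions \<open>0, 1, r 3, ..., r n\<close> over to the
    index type through the inverse of \<open>e\<close>.\<close>
  define X where "X m = (let j = inv_into {1..n} e m in
      if j = 1 then \<lambda>_. 0 else if j = 2 then \<lambda>_. 1 else r j)" for m
  have inv: "inv_into {1..n} e (e j) = j" if "j \<in> {1..n}" for j
    using enum that by (meson bij_betw_def inv_into_f_f)
  have X1: "X (e 1) = (\<lambda>_. 0)" and X2: "X (e 2) = (\<lambda>_. 1)"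
    and Xr: "\<And>j. j \<in> {3..n} \<Longrightarrow> X (e j) = r j"
    using n_ge_3 inv by (auto simp: X_def)
  have split: "{1..n} = insert 1 (insert 2 {3..n})" using n_ge_3 by auto
  have cases: "(\<forall>m. P m) \<longleftrightarrow> P (e 1) \<and> P (e 2) \<and> (\<forall>j\<in>{3..n}. P (e j))" for P
  proof -
    have "(\<forall>m. P m) \<longleftrightarrow> (\<forall>j\<in>{1..n}. P (e j))"
      using bij_betw_imp_surj_on[OF enum] by (metis UNIV_I imageE)
    then show ?thesis by (simp only: split ball_simps)
  qed
  have sum: "(\<Sum>m\<in>UNIV. f m) = f (e 1) + (f (e 2) + (\<Sum>j=3..n. f (e j)))" for f :: "'n \<Rightarrow> real"
    unfolding sum.reindex_bij_betw[OF enum, symmetric] split by simp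
  have const: "smooth_on I (\<lambda>_. c)" for c :: real
    using smooth_on_quadratic[of I c 0 0] by simp
  have "\<forall>m. smooth_on I (X m)"
    unfolding cases using r_smooth by (simp add: X1 X2 Xr const del: One_nat_def)
  moreover have "\<forall>m. \<forall>t\<in>I. \<gamma> t $ m = z t * of_real (X m t)"
    unfolding cases using coords by (simp add: X1 X2 Xr del: One_nat_def)
  ultimately have "is_geodesic (M_space (e 1)) I \<gamma> \<longleftrightarrow>
    (\<exists>k1. \<forall>t\<in>I. (\<Sum>m\<in>UNIV. (X m t)\<^sup>2) * (ddt z t \<bullet> (\<i> * z t)) = k1) \<and>
    (\<forall>t\<in>I. ddt (ddt z) t \<bullet> z t = 0) \<and>
    (\<forall>m. \<exists>c. \<forall>t\<in>I. ddt (X m) t * (norm (z t))\<^sup>2 = c) \<and>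
    (\<exists>k0. \<forall>t\<in>I. (\<Sum>m\<in>UNIV. (ddt (X m) t)\<^sup>2 * (norm (z t))\<^sup>2)
         + (\<Sum>m\<in>UNIV. 2 * ddt (X m) t * X m t * (z t \<bullet> ddt z t))
         + (\<Sum>m\<in>UNIV. (X m t)\<^sup>2) * (norm (ddt z t))\<^sup>2 = k0)"
    by (intro geodesic_M_space_iff[where k = "e 2"])
      (use z_smooth z_nz curve X1 X2 in \<open>auto simp: I_def\<close>)
  also have "\<dots> \<longleftrightarrow>
    (\<exists>k1. \<forall>t\<in>I. (1 + (\<Sum>j=3..n. (r j t)\<^sup>2)) * (ddt z t \<bullet> (\<i> * z t)) = k1) \<and>
    (\<forall>t\<in>I. ddt (ddt z) t \<bullet> z t = 0) \<and>
    (\<forall>j\<in>{3..n}. \<exists>c. \<forall>t\<in>I. ddt (r j) t * (norm (z t))\<^sup>2 = c) \<and>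
    (\<exists>k0. \<forall>t\<in>I. (\<Sum>j=3..n. (ddt (r j) t)\<^sup>2 * (norm (z t))\<^sup>2)
         + (\<Sum>j=3..n. 2 * ddt (r j) t * r j t * (z t \<bullet> ddt z t))
         + (1 + (\<Sum>j=3..n. (r j t)\<^sup>2)) * (norm (ddt z t))\<^sup>2 = k0)"
    \<comment> \<open>At \<open>e 1\<close> and \<open>e 2\<close> the functions are constant, so
      their derivatives vanish and their (III) conditions hold trivially. Their only contribution is
      the summand 1 from \<open>X (e 2)\<close>.\<close>
    unfolding cases sum by (simp add: X1 X2 Xr del: One_nat_def)
  finally show ?thesis by (simp only: collect_constants)
qed

end
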